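(* In the successor algebra, the satisfiability of a size problem (i.e. whether it has at least one solution) is decidable in time polynomial in the number of symbols of the problem.
   Context: Let $\mathcal V$ be a set of size variables and $\mathcal C$ an infinite set of size constants, disjoint from $\mathcal V$. The successor size algebra $\mathcal A$ is the set of first-order terms built from $\mathcal V$, the constants of $\mathcal C$ and a unary symbol $\mathsf s$. The relation $\prec$ is the smallest strict ordering on $\mathcal A$ with $a\prec\mathsf s\,a$ for all $a$, and $\preceq$ its reflexive closure. Let $\bar{\mathcal A}=\mathcal A\cup\{\infty\}$ with $\infty\notin\mathcal A$, and $a\preceq_\infty b$ iff $a\preceq b$ or $b=\infty$. A size substitution $\varphi:\mathcal V\to\bar{\mathcal A}$ (with finite domain) is applied to $a\in\bar{\mathcal A}$ by setting $a\varphi=\infty$ if $a=\infty$ or $a$ contains a variable mapped to $\infty$, and by ordinary replacement otherwise. A size problem $P$ is either $\bot$ or a finite set of constraints $a\le^?b$ with $a,b\in\bar{\mathcal A}$. A solution of $P$ is a size substitution $\varphi$ such that $P\ne\bot$, the domain of $\varphi$ is included in the set of size variables occurring in $P$, and $a\varphi\preceq_\infty b\varphi$ for every constraint $a\le^?b\in P$. *)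

theory Defs
  imports Main "HOL-Computational_Algebra.Polynomial"
begin

section \<open>Size problems in the successor algebra\<close>

text \<open>The sets of size variables and of size constants are the types \<open>'v\<close> and \<open>'c\<close>; they are
  disjoint because variables and constants carry different constructors.\<close>

datatype ('v, 'c) sz = Var 'v | Con 'c | Succ "('v, 'c) sz"

inductive prec :: "('v, 'c) sz \<Rightarrow> ('v, 'c) sz \<Rightarrow> bool"  (infix "\<prec>" 50) where
  prec_Succ: "a \<prec> Succ a"
| prec_trans: "a \<prec> b \<Longrightarrow> b \<prec> c \<Longrightarrow> a \<prec> c"

text \<open>The least transitive relation containing all \<open>(a, Succ a)\<close> is irreflexive, so it is also the
  least strict ordering containing them.\<close>

lemma prec_size: "a \<prec> b \<Longrightarrow> size a < size b"
  by (induction rule: prec.induct) auto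

lemma prec_smallest_strict_order:
  shows "irreflp ((\<prec>) :: ('v, 'c) sz \<Rightarrow> _)"
    and "transp ((\<prec>) :: ('v, 'c) sz \<Rightarrow> _)"
    and "(\<And>a. R a (Succ a)) \<Longrightarrow> transp R \<Longrightarrow> (a :: ('v, 'c) sz) \<prec> b \<Longrightarrow> R a b"
proof -
  show "irreflp ((\<prec>) :: ('v, 'c) sz \<Rightarrow> _)"
    using prec_size by (fastforce intro: irreflpI)
  show "transp ((\<prec>) :: ('v, 'c) sz \<Rightarrow> _)"
    by (blast intro: transpI prec_trans)
  show "R a b" if R: "\<And>a. R a (Succ a)" "transp R" and "a \<prec> b" for a b :: "('v, 'c) sz" and R
    using that(3) by (induction rule: prec.induct) (auto intro: R(1) transpD[OF R(2)])
qed

definition preceq :: "('v, 'c) sz \<Rightarrow> ('v, 'c) sz \<Rightarrow> bool"  (infix "\<preceq>" 50) where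
  "a \<preceq> b \<longleftrightarrow> a \<prec> b \<or> a = b"

datatype ('v, 'c) xsz = Fin "('v, 'c) sz" | Infty

definition preceq_inf :: "('v, 'c) xsz \<Rightarrow> ('v, 'c) xsz \<Rightarrow> bool"  (infix "\<preceq>\<^sub>\<infinity>" 50) where
  "a \<preceq>\<^sub>\<infinity> b \<longleftrightarrow> (\<exists>a' b'. a = Fin a' \<and> b = Fin b' \<and> a' \<preceq> b') \<or> b = Infty"

type_synonym ('v, 'c) subst = "'v \<Rightarrow> ('v, 'c) xsz"

definition subst_dom :: "('v, 'c) subst \<Rightarrow> 'v set" where
  "subst_dom \<phi> = {x. \<phi> x \<noteq> Fin (Var x)}"

definition is_size_subst :: "('v, 'c) subst \<Rightarrow> bool" where
  "is_size_subst \<phi> \<longleftrightarrow> finite (subst_dom \<phi>)"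

primrec vars_sz :: "('v, 'c) sz \<Rightarrow> 'v set" where
  "vars_sz (Var x) = {x}"
| "vars_sz (Con c) = {}"
| "vars_sz (Succ a) = vars_sz a"

primrec vars_xsz :: "('v, 'c) xsz \<Rightarrow> 'v set" where
  "vars_xsz (Fin a) = vars_sz a"
| "vars_xsz Infty = {}"

primrec apply_sz :: "('v, 'c) subst \<Rightarrow> ('v, 'c) sz \<Rightarrow> ('v, 'c) xsz" where
  "apply_sz \<phi> (Var x) = \<phi> x"
| "apply_sz \<phi> (Con c) = Fin (Con c)"
| "apply_sz \<phi> (Succ a) = (case apply_sz \<phi> a of Fin b \<Rightarrow> Fin (Succ b) | Infty \<Rightarrow> Infty)"

primrec apply_xsz :: "('v, 'c) subst \<Rightarrow> ('v, 'c) xsz \<Rightarrow> ('v, 'c) xsz" where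
  "apply_xsz \<phi> (Fin a) = apply_sz \<phi> a"
| "apply_xsz \<phi> Infty = Infty"

lemma apply_sz_eq_Infty_iff: "apply_sz \<phi> a = Infty \<longleftrightarrow> (\<exists>x \<in> vars_sz a. \<phi> x = Infty)"
  by (induction a) (auto split: xsz.splits)

text \<open>A pair \<open>(a, b)\<close> stands for the constraint \<open>a \<le>\<^sup>? b\<close>.\<close>

type_synonym ('v, 'c) constraint = "('v, 'c) xsz \<times> ('v, 'c) xsz"

datatype ('v, 'c) problem = Bot | Constraints "('v, 'c) constraint set"

primrec is_size_problem :: "('v, 'c) problem \<Rightarrow> bool" where
  "is_size_problem Bot = True"
| "is_size_problem (Constraints K) = finite K"

primrec vars_problem :: "('v, 'c) problem \<Rightarrow> 'v set" where
  "vars_problem Bot = {}"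
| "vars_problem (Constraints K) = (\<Union>(a, b) \<in> K. vars_xsz a \<union> vars_xsz b)"

definition solution :: "('v, 'c) problem \<Rightarrow> ('v, 'c) subst \<Rightarrow> bool" where
  "solution P \<phi> \<longleftrightarrow> is_size_subst \<phi> \<and> subst_dom \<phi> \<subseteq> vars_problem P \<and>
     (\<exists>K. P = Constraints K \<and> (\<forall>(a, b) \<in> K. apply_xsz \<phi> a \<preceq>\<^sub>\<infinity> apply_xsz \<phi> b))"

definition satisfiable :: "('v, 'c) problem \<Rightarrow> bool" where
  "satisfiable P \<longleftrightarrow> (\<exists>\<phi>. solution P \<phi>)"

text \<open>Number of symbols, counting every occurrence of a variable, of a constant, of the successor
  symbol, of \<open>\<infinity>\<close>, of \<open>\<le>\<^sup>?\<close> and of \<open>\<bottom>\<close> as one.\<close>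

primrec symbols_sz :: "('v, 'c) sz \<Rightarrow> nat" where
  "symbols_sz (Var x) = 1"
| "symbols_sz (Con c) = 1"
| "symbols_sz (Succ a) = Suc (symbols_sz a)"

primrec symbols_xsz :: "('v, 'c) xsz \<Rightarrow> nat" where
  "symbols_xsz (Fin a) = symbols_sz a"
| "symbols_xsz Infty = 1"

primrec symbols :: "('v, 'c) problem \<Rightarrow> nat" where
  "symbols Bot = 1"
| "symbols (Constraints K) = (\<Sum>(a, b) \<in> K. symbols_xsz a + 1 + symbols_xsz b)"


section \<open>Polynomial time\<close>

text \<open>The model of computation is the language WHILE of Jones (Computability and Complexity from a
  Programming Perspective, MIT Press 1997): imperative programs over binary trees, where every
  operator of an expression and every command costs one step. WHILE programs and Turing machines
  simulate each other with polynomial overhead; in particular trees can be shared, so that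
  \<open>t\<close> steps create at most \<open>t\<close> new nodes. Equality can be tested on leaves only.

  Leaves are either nil or atoms. Atoms play the role of the names occurring in the input. A program
  cannot mention any particular atom: all it can do with atoms is to copy them and to test
  them for equality. Since a run only meets atoms of its input, spelling \<open>n\<close> different atoms as
  words of length logarithmic in \<open>n\<close> over a finite alphabet only adds polynomial overhead.\<close>

datatype 'a tree = Nul | Atom 'a | Pair "'a tree" "'a tree"

type_synonym 'a store = "nat \<Rightarrow> 'a tree"

datatype exp = X nat | NIL | CONS exp exp | HD exp | TL exp | ATOM_EQ exp exp

fun hd_tree :: "'a tree \<Rightarrow> 'a tree" where
  "hd_tree (Pair l r) = l"
| "hd_tree _ = Nul"

fun tl_tree :: "'a tree \<Rightarrow> 'a tree" where
  "tl_tree (Pair l r) = r"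
| "tl_tree _ = Nul"

definition true_tree :: "'a tree" where
  "true_tree = Pair Nul Nul"

fun atom_eq :: "'a tree \<Rightarrow> 'a tree \<Rightarrow> bool" where
  "atom_eq Nul Nul = True"
| "atom_eq (Atom x) (Atom y) = (x = y)"
| "atom_eq _ _ = False"

primrec eval_exp :: "exp \<Rightarrow> 'a store \<Rightarrow> 'a tree" where
  "eval_exp (X i) s = s i"
| "eval_exp NIL s = Nul"
| "eval_exp (CONS e f) s = Pair (eval_exp e s) (eval_exp f s)"
| "eval_exp (HD e) s = hd_tree (eval_exp e s)"
| "eval_exp (TL e) s = tl_tree (eval_exp e s)"
| "eval_exp (ATOM_EQ e f) s = (if atom_eq (eval_exp e s) (eval_exp f s) then true_tree else Nul)"

primrec exp_cost :: "exp \<Rightarrow> nat" where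
  "exp_cost (X i) = 1"
| "exp_cost NIL = 1"
| "exp_cost (CONS e f) = 1 + exp_cost e + exp_cost f"
| "exp_cost (HD e) = 1 + exp_cost e"
| "exp_cost (TL e) = 1 + exp_cost e"
| "exp_cost (ATOM_EQ e f) = 1 + exp_cost e + exp_cost f"

datatype com =
    SKIP
  | ASSIGN nat exp
  | SEQ com com
  | IF exp com com
  | WHILE exp com

text \<open>\<open>exec c s t s'\<close>: started in store \<open>s\<close>, the command \<open>c\<close> terminates after \<open>t\<close> steps in store
  \<open>s'\<close>. Nil is false, every other tree is true.\<close>

inductive exec :: "com \<Rightarrow> 'a store \<Rightarrow> nat \<Rightarrow> 'a store \<Rightarrow> bool" where
  exec_SKIP: "exec SKIP s 1 s"
| exec_ASSIGN: "exec (ASSIGN i e) s (1 + exp_cost e) (s(i := eval_exp e s))"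
| exec_SEQ: "exec c s t s' \<Longrightarrow> exec d s' u s'' \<Longrightarrow> exec (SEQ c d) s (1 + t + u) s''"
| exec_IF_true: "eval_exp e s \<noteq> Nul \<Longrightarrow> exec c s t s' \<Longrightarrow>
    exec (IF e c d) s (1 + exp_cost e + t) s'"
| exec_IF_false: "eval_exp e s = Nul \<Longrightarrow> exec d s t s' \<Longrightarrow>
    exec (IF e c d) s (1 + exp_cost e + t) s'"
| exec_WHILE_false: "eval_exp e s = Nul \<Longrightarrow> exec (WHILE e c) s (1 + exp_cost e) s"
| exec_WHILE_true: "eval_exp e s \<noteq> Nul \<Longrightarrow> exec c s t s' \<Longrightarrow> exec (WHILE e c) s' u s'' \<Longrightarrow>
    exec (WHILE e c) s (1 + exp_cost e + t + u) s''"

inductive_cases exec_SKIP_E: "exec SKIP s t s'"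
inductive_cases exec_ASSIGN_E: "exec (ASSIGN i e) s t s'"
inductive_cases exec_SEQ_E: "exec (SEQ c d) s t s'"
inductive_cases exec_IF_E: "exec (IF e c d) s t s'"
inductive_cases exec_WHILE_E: "exec (WHILE e c) s t s'"

lemma exec_deterministic:
  "exec c s t s' \<Longrightarrow> exec c s u s'' \<Longrightarrow> t = u \<and> s' = s''"
proof (induction arbitrary: u s'' rule: exec.induct)
  case (exec_SEQ c s t s1 d t' s2)
  from exec_SEQ.prems obtain v w r where "exec c s v r" "exec d r w s''" "u = 1 + v + w"
    by (auto elim: exec_SEQ_E)
  with exec_SEQ.IH show ?case by metis
next
  case (exec_IF_true e s c t s1 d)
  from exec_IF_true.prems exec_IF_true.hyps obtain v where "exec c s v s''" "u = 1 + exp_cost e + v"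
    by (auto elim: exec_IF_E)
  with exec_IF_true.IH show ?case by metis
next
  case (exec_IF_false e s d t s1 c)
  from exec_IF_false.prems exec_IF_false.hyps obtain v where "exec d s v s''" "u = 1 + exp_cost e + v"
    by (auto elim: exec_IF_E)
  with exec_IF_false.IH show ?case by metis
next
  case (exec_WHILE_true e s c t s1 t' s2)
  from exec_WHILE_true.prems exec_WHILE_true.hyps obtain v w r
    where "exec c s v r" "exec (WHILE e c) r w s''" "u = 1 + exp_cost e + v + w"
    by (auto elim: exec_WHILE_E)
  with exec_WHILE_true.IH show ?case by metis
qed (auto elim: exec_SKIP_E exec_ASSIGN_E exec_WHILE_E)

text \<open>The input is put into variable 0, and the answer is read off from variable 0.\<close>

definition input_store :: "'a tree \<Rightarrow> 'a store" where
  "input_store d = (\<lambda>_. Nul)(0 := d)"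

text \<open>\<open>codes x\<close> is the set of admissible input representations of the instance \<open>x\<close>; the program has
  to answer correctly and in time for each of them.\<close>

definition polytime_decidable ::
  "'i set \<Rightarrow> ('i \<Rightarrow> 'a tree set) \<Rightarrow> ('i \<Rightarrow> nat) \<Rightarrow> ('i \<Rightarrow> bool) \<Rightarrow> bool" where
  "polytime_decidable I codes meas Q \<longleftrightarrow>
     (\<exists>(c :: com) (p :: nat poly). \<forall>x \<in> I. \<forall>d \<in> codes x.
        \<exists>t s. exec c (input_store d) t s \<and> t \<le> poly p (meas x) \<and> (s 0 \<noteq> Nul \<longleftrightarrow> Q x))"


section \<open>Size problems as inputs\<close>

primrec tag :: "nat \<Rightarrow> 'a tree" where
  "tag 0 = Nul"
| "tag (Suc n) = Pair Nul (tag n)"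

primrec code_sz :: "('v, 'c) sz \<Rightarrow> ('v + 'c) tree" where
  "code_sz (Var x) = Pair (tag 1) (Atom (Inl x))"
| "code_sz (Con c) = Pair (tag 2) (Atom (Inr c))"
| "code_sz (Succ a) = Pair (tag 3) (code_sz a)"

primrec code_xsz :: "('v, 'c) xsz \<Rightarrow> ('v + 'c) tree" where
  "code_xsz (Fin a) = code_sz a"
| "code_xsz Infty = Pair (tag 0) Nul"

primrec code_list :: "('v, 'c) constraint list \<Rightarrow> ('v + 'c) tree" where
  "code_list [] = Nul"
| "code_list (k # ks) = Pair (Pair (code_xsz (fst k)) (code_xsz (snd k))) (code_list ks)"

text \<open>A finite set of constraints is represented by any repetition-free enumeration of it.\<close>

primrec problem_codes :: "('v, 'c) problem \<Rightarrow> ('v + 'c) tree set" where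
  "problem_codes Bot = {Nul}"
| "problem_codes (Constraints K) = {Pair Nul (code_list ks) | ks. set ks = K \<and> distinct ks}"

end

theory Submission
  imports Defs
begin

text \<open>Keep an upper bound \<open>\<psi>\<close> of all solutions, starting with \<open>\<psi> x = \<infinity>\<close> for every variable. If \<open>\<psi>\<close>
  violates a constraint \<open>s\<^sup>m u \<le>\<^sup>? b\<close>, then \<open>b\<psi>\<close> is finite. Every solution \<open>\<phi>\<close> has
  \<open>u\<phi> \<preceq> s\<^sup>m u\<phi> \<preceq> b\<psi>\<close>, so \<open>u\<close> has to be a variable, whose bound is lowered to \<open>b\<psi>\<close> if it was \<open>\<infinity>\<close> and by
  one successor otherwise; if this is impossible, there is no solution. A \<open>\<psi>\<close> violating no constraint
  is itself a solution, the greatest one. For \<open>n\<close> symbols, a variable that gets a finite bound exceeds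
  the bounds present before by at most \<open>n\<close>, so all finite bounds have height at most \<open>n\<^sup>2\<close>, which limits
  the number of updates.\<close>

section \<open>A weakest-precondition calculus that counts steps\<close>

section \<open>Running WHILE programs\<close>

text \<open>Execution is deterministic, so this is the weakest precondition for total correctness,
  with the step count passed to the postcondition. The equations below let the simplifier execute
  loop-free code symbolically.\<close>

definition runs :: "com \<Rightarrow> 'a store \<Rightarrow> (nat \<Rightarrow> 'a store \<Rightarrow> bool) \<Rightarrow> bool" where
  "runs c s Q \<longleftrightarrow> (\<exists>t s'. exec c s t s' \<and> Q t s')"

lemma runs_mono: "runs c s Q \<Longrightarrow> (\<And>t s'. Q t s' \<Longrightarrow> R t s') \<Longrightarrow> runs c s R"
  unfolding runs_def by blast

lemma runs_SKIP [simp]: "runs SKIP s Q = Q 1 s"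
proof -
  have "exec SKIP s t s' \<longleftrightarrow> t = 1 \<and> s' = s" for t s'
    using exec_SKIP by (auto elim: exec_SKIP_E)
  then show ?thesis by (simp add: runs_def)
qed

lemma runs_ASSIGN [simp]:
  "runs (ASSIGN i e) s Q = Q (1 + exp_cost e) (s(i := eval_exp e s))"
proof -
  have "exec (ASSIGN i e) s t s' \<longleftrightarrow> t = 1 + exp_cost e \<and> s' = s(i := eval_exp e s)" for t s'
    using exec_ASSIGN by (auto elim: exec_ASSIGN_E)
  then show ?thesis by (simp add: runs_def)
qed

lemma runs_SEQ [simp]:
  "runs (SEQ c d) s Q = runs c s (\<lambda>t s'. runs d s' (\<lambda>u s''. Q (1 + t + u) s''))"
  (is "?L = ?R")
proof
  assume ?L
  then obtain t s'' where "exec (SEQ c d) s t s''" and Q: "Q t s''" unfolding runs_def by blast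
  then obtain u v s' where "exec c s u s'" "exec d s' v s''" "t = 1 + u + v"
    by (elim exec_SEQ_E) simp
  with Q show ?R unfolding runs_def by (intro exI conjI) simp_all
next
  assume ?R
  then obtain t s' u s'' where "exec c s t s'" "exec d s' u s''" "Q (1 + t + u) s''"
    unfolding runs_def by (elim exE conjE)
  then show ?L unfolding runs_def by (intro exI conjI) (rule exec_SEQ)
qed

lemma runs_IF [simp]:
  "runs (IF e c d) s Q =
     runs (if eval_exp e s \<noteq> Nul then c else d) s (\<lambda>t. Q (1 + exp_cost e + t))"
  (is "?L = ?R")
proof
  assume ?L
  then obtain t s'' where "exec (IF e c d) s t s''" and Q: "Q t s''" unfolding runs_def by blast
  then obtain u where "exec (if eval_exp e s \<noteq> Nul then c else d) s u s''" "t = 1 + exp_cost e + u"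
    by (elim exec_IF_E) simp_all
  with Q show ?R unfolding runs_def by (intro exI conjI) simp_all
next
  assume ?R
  then obtain t s' where
    ex: "exec (if eval_exp e s \<noteq> Nul then c else d) s t s'" and Q: "Q (1 + exp_cost e + t) s'"
    unfolding runs_def by (elim exE conjE)
  have "exec (IF e c d) s (1 + exp_cost e + t) s'"
    using ex exec_IF_true[of e s c t s' d] exec_IF_false[of e s d t s' c]
    by (cases "eval_exp e s = Nul") simp_all
  with Q show ?L unfolding runs_def by (intro exI conjI)
qed

lemma runs_WHILE_false:
  assumes "eval_exp e s = Nul"
  shows "runs (WHILE e c) s Q = Q (1 + exp_cost e) s"
proof -
  have "exec (WHILE e c) s t s' \<longleftrightarrow> t = 1 + exp_cost e \<and> s' = s" for t s'
    using exec_WHILE_false[OF assms, of c] assms by (auto elim: exec_WHILE_E)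
  then show ?thesis by (simp add: runs_def)
qed

lemma runs_WHILE_true:
  assumes "eval_exp e s \<noteq> Nul"
  shows "runs (WHILE e c) s Q =
    runs c s (\<lambda>t s'. runs (WHILE e c) s' (\<lambda>u. Q (1 + exp_cost e + t + u)))"
  (is "?L = ?R")
proof
  assume ?L
  then obtain t s'' where "exec (WHILE e c) s t s''" and Q: "Q t s''" unfolding runs_def by blast
  then obtain u v s' where "exec c s u s'" "exec (WHILE e c) s' v s''" "t = 1 + exp_cost e + u + v"
    using assms by (auto elim: exec_WHILE_E[of e c s t s''])
  with Q show ?R unfolding runs_def by (intro exI conjI) simp_all
next
  assume ?R
  then obtain t s' u s'' where "exec c s t s'" "exec (WHILE e c) s' u s''"
    "Q (1 + exp_cost e + t + u) s''"
    unfolding runs_def by (elim exE conjE)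
  then show ?L unfolding runs_def by (intro exI conjI) (rule exec_WHILE_true[OF assms])
qed

text \<open>The measure \<open>n\<close> drops in every round, so the body runs at most
  \<open>n\<close> times; the \<open>1\<close> in \<open>n + 1\<close> pays for the last, failing
  test of the guard.\<close>

lemma runs_WHILE_measure:
  assumes step: "\<And>n s. I n s \<Longrightarrow> eval_exp e s \<noteq> Nul \<Longrightarrow>
      runs c s (\<lambda>t s'. t \<le> T \<and> (\<exists>n'<n. I n' s'))"
    and init: "I n s"
  shows "runs (WHILE e c) s
    (\<lambda>t s'. t \<le> (n + 1) * (T + 1 + exp_cost e) \<and> (\<exists>n'. I n' s') \<and> eval_exp e s' = Nul)"
  using init
proof (induction n arbitrary: s rule: less_induct)
  case (less n)
  show ?case
  proof (cases "eval_exp e s = Nul")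
    case True
    with less.prems show ?thesis by (simp add: runs_WHILE_false) auto
  next
    case False
    have "runs c s (\<lambda>t s'. runs (WHILE e c) s' (\<lambda>u s''.
      1 + exp_cost e + t + u \<le> (n + 1) * (T + 1 + exp_cost e) \<and> (\<exists>n'. I n' s'')
        \<and> eval_exp e s'' = Nul))"
    proof (rule runs_mono[OF step[OF less.prems False]], elim conjE exE)
      fix t s' n' assume t: "t \<le> T" and n': "n' < n" "I n' s'"
      have le: "(n' + 1) * (T + 1 + exp_cost e) + (T + 1 + exp_cost e) \<le>
          (n + 1) * (T + 1 + exp_cost e)"
        using mult_le_mono1[of "n' + 2" "n + 1" "T + 1 + exp_cost e"] n'(1)
        by (simp add: algebra_simps)
      show "runs (WHILE e c) s' (\<lambda>u s''.
        1 + exp_cost e + t + u \<le> (n + 1) * (T + 1 + exp_cost e) \<and> (\<exists>n'. I n' s'')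
          \<and> eval_exp e s'' = Nul)"
        by (rule runs_mono[OF less.IH[OF n']]) (use le t in auto)
    qed
    with False show ?thesis by (simp add: runs_WHILE_true)
  qed
qed


section \<open>Structure of the order, monotonicity of substitution\<close>

section \<open>The ordering\<close>

text \<open>Only successor steps generate the order, so a chain of steps amounts to its length, and
  lengths add up under transitivity.\<close>

lemma preceq_iff_funpow: "a \<preceq> b \<longleftrightarrow> (\<exists>k. b = (Succ ^^ k) a)"
proof
  have "a \<prec> b \<Longrightarrow> \<exists>k. b = (Succ ^^ k) a"
  proof (induction rule: prec.induct)
    case (prec_Succ a)
    have "Succ a = (Succ ^^ 1) a" by simp
    then show ?case by blast
  next
    case (prec_trans a b c)
    then obtain j k where "b = (Succ ^^ j) a" "c = (Succ ^^ k) b" by blast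
    then have "c = (Succ ^^ (k + j)) a" by (simp add: funpow_add)
    then show ?case by blast
  qed
  moreover have "a = (Succ ^^ 0) a" by simp
  ultimately show "a \<preceq> b \<Longrightarrow> \<exists>k. b = (Succ ^^ k) a"
    unfolding preceq_def by blast
next
  have "a \<preceq> (Succ ^^ k) a" for k
    by (induction k) (auto simp: preceq_def intro: prec_Succ prec_trans)
  then show "\<exists>k. b = (Succ ^^ k) a \<Longrightarrow> a \<preceq> b" by blast
qed

lemma preceq_trans: "a \<preceq> b \<Longrightarrow> b \<preceq> c \<Longrightarrow> a \<preceq> c"
  unfolding preceq_def using prec_trans by blast

lemma preceq_refl: "a \<preceq> a"
  by (simp add: preceq_def)

lemma preceq_Succ_mono: "a \<preceq> b \<Longrightarrow> Succ a \<preceq> Succ b"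
  unfolding preceq_iff_funpow by (metis funpow_swap1)

lemma preceq_inf_Infty [simp]: "a \<preceq>\<^sub>\<infinity> Infty"
  by (simp add: preceq_inf_def)

lemma not_Infty_preceq_inf_Fin [simp]: "\<not> Infty \<preceq>\<^sub>\<infinity> Fin b"
  by (simp add: preceq_inf_def)

lemma preceq_inf_Fin [simp]: "Fin a \<preceq>\<^sub>\<infinity> Fin b \<longleftrightarrow> a \<preceq> b"
  by (simp add: preceq_inf_def)

lemma preceq_inf_trans: "a \<preceq>\<^sub>\<infinity> b \<Longrightarrow> b \<preceq>\<^sub>\<infinity> c \<Longrightarrow> a \<preceq>\<^sub>\<infinity> c"
  by (cases a; cases b; cases c) (auto intro: preceq_trans)

lemma apply_sz_mono:
  "(\<And>x. x \<in> vars_sz a \<Longrightarrow> \<phi> x \<preceq>\<^sub>\<infinity> \<psi> x) \<Longrightarrow> apply_sz \<phi> a \<preceq>\<^sub>\<infinity> apply_sz \<psi> a"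
  by (induction a) (auto simp: preceq_refl split: xsz.splits intro: preceq_Succ_mono)

lemma apply_xsz_mono:
  "(\<And>x. x \<in> vars_xsz a \<Longrightarrow> \<phi> x \<preceq>\<^sub>\<infinity> \<psi> x) \<Longrightarrow> apply_xsz \<phi> a \<preceq>\<^sub>\<infinity> apply_xsz \<psi> a"
  by (cases a) (auto intro: apply_sz_mono)

lemma apply_sz_cong:
  "(\<And>x. x \<in> vars_sz a \<Longrightarrow> \<phi> x = \<psi> x) \<Longrightarrow> apply_sz \<phi> a = apply_sz \<psi> a"
  by (induction a) auto

lemma apply_xsz_cong:
  "(\<And>x. x \<in> vars_xsz a \<Longrightarrow> \<phi> x = \<psi> x) \<Longrightarrow> apply_xsz \<phi> a = apply_xsz \<psi> a"
  by (cases a) (auto intro: apply_sz_cong)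


section \<open>Candidate upper bounds as association lists\<close>

section \<open>Environments\<close>

primrec base :: "('v, 'c) sz \<Rightarrow> ('v, 'c) sz" where
  "base (Var x) = Var x"
| "base (Con c) = Con c"
| "base (Succ a) = base a"

primrec height :: "('v, 'c) sz \<Rightarrow> nat" where
  "height (Var x) = 0"
| "height (Con c) = 0"
| "height (Succ a) = Suc (height a)"

primrec xbase :: "('v, 'c) xsz \<Rightarrow> ('v, 'c) xsz" where
  "xbase (Fin a) = Fin (base a)"
| "xbase Infty = Infty"

primrec xheight :: "('v, 'c) xsz \<Rightarrow> nat" where
  "xheight (Fin a) = height a"
| "xheight Infty = 0"

lemma base_not_Succ [simp]: "base a \<noteq> Succ b"
  by (induction a) auto

lemma funpow_height_base: "(Succ ^^ height a) (base a) = a"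
  by (induction a) auto

lemma height_funpow [simp]: "height ((Succ ^^ k) a) = k + height a"
  by (induction k) auto

lemma base_funpow [simp]: "base ((Succ ^^ k) a) = base a"
  by (induction k) auto

text \<open>This reduces comparison to one leaf and two numbers, which is what \<open>CMP\<close>
  can test.\<close>

lemma preceq_iff_base_height: "a \<preceq> b \<longleftrightarrow> base a = base b \<and> height a \<le> height b"
proof
  assume "base a = base b \<and> height a \<le> height b"
  moreover from this have "Succ ^^ height b = (Succ ^^ (height b - height a)) \<circ> (Succ ^^ height a)"
    by (simp flip: funpow_add)
  ultimately have "(Succ ^^ (height b - height a)) ((Succ ^^ height a) (base a)) =
      (Succ ^^ height b) (base b)"
    by (metis comp_apply)
  then have "b = (Succ ^^ (height b - height a)) a"
    unfolding funpow_height_base by (rule sym)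
  then show "a \<preceq> b" by (auto simp: preceq_iff_funpow)
qed (auto simp: preceq_iff_funpow)

type_synonym ('v, 'c) env = "('v \<times> ('v, 'c) sz) list"

text \<open>Unlisted variables are bounded by \<infinity>, so the empty list is the initial bound.
  An update prepends an entry that shadows older ones, hence the length counts the updates.\<close>

definition env :: "('v, 'c) env \<Rightarrow> ('v, 'c) subst" where
  "env U x = (case map_of U x of None \<Rightarrow> Infty | Some t \<Rightarrow> Fin t)"

lemma env_Nil [simp]: "env [] x = Infty"
  by (simp add: env_def)

lemma env_Cons [simp]: "env ((y, t) # U) x = (if x = y then Fin t else env U x)"
  by (simp add: env_def)

definition ground_env :: "('v, 'c) env \<Rightarrow> bool" where
  "ground_env U \<longleftrightarrow> (\<forall>(x, t) \<in> set U. vars_sz t = {})"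

lemma env_in_set: "env U x = Fin t \<Longrightarrow> (x, t) \<in> set U"
  by (auto simp: env_def split: option.splits dest: map_of_SomeD)

lemma env_ground: "ground_env U \<Longrightarrow> env U x = Fin t \<Longrightarrow> vars_sz t = {}"
  unfolding ground_env_def by (auto dest: env_in_set)

text \<open>An unlisted variable turns the whole value into \<infinity>, so no variable survives
  inside a finite value.\<close>

lemma apply_sz_env_ground:
  "ground_env U \<Longrightarrow> apply_sz (env U) a = Fin t \<Longrightarrow> vars_sz t = {}"
  by (induction a arbitrary: t) (auto split: xsz.splits dest: env_ground)

lemma apply_xsz_env_ground:
  "ground_env U \<Longrightarrow> apply_xsz (env U) a = Fin t \<Longrightarrow> vars_sz t = {}"
  by (cases a) (auto dest: apply_sz_env_ground)

lemma ground_base: "vars_sz t = {} \<Longrightarrow> \<exists>c. base t = Con c"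
  by (induction t) auto

text \<open>Only the innermost symbol needs a lookup; \<open>EVAL\<close> computes values in this
  way.\<close>

lemma apply_sz_base:
  "apply_sz \<phi> a = (case apply_sz \<phi> (base a) of Fin t \<Rightarrow> Fin ((Succ ^^ height a) t) | Infty \<Rightarrow> Infty)"
  by (induction a) (auto split: xsz.splits)

lemma height_apply_sz:
  assumes "apply_sz \<phi> a = Fin t" and "\<And>x u. x \<in> vars_sz a \<Longrightarrow> \<phi> x = Fin u \<Longrightarrow> height u \<le> B"
  shows "height t \<le> height a + B"
  using assms
proof (induction a arbitrary: t)
  case (Succ a)
  then obtain t' where "apply_sz \<phi> a = Fin t'" "t = Succ t'" by (auto split: xsz.splits)
  with Succ show ?case by fastforce
qed auto


section \<open>Programs for evaluation and comparison\<close>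

section \<open>Elementary operations on codes\<close>

text \<open>Registers: 0 answer, 1 all constraints, 2 environment, 3 constraints still to be checked,
  4 argument of \<open>EVAL\<close>, 5 its base, 6 value of the base, 7 value of the argument, 8 scan pointer of
  the lookup, 9 value of the right-hand side, 11 working copy of it, 12 result of the comparison.\<close>

lemma code_sz_simps:
  "code_sz (Var x) = Pair (Pair Nul Nul) (Atom (Inl x))"
  "code_sz (Con c) = Pair (Pair Nul (Pair Nul Nul)) (Atom (Inr c))"
  "code_sz (Succ a) = Pair (Pair Nul (Pair Nul (Pair Nul Nul))) (code_sz a)"
  by (simp_all add: numeral_2_eq_2 numeral_3_eq_3)

declare code_sz.simps [simp del]
declare code_sz_simps [simp]

text \<open>Tags are unary numerals: 0 for \<infinity>, 1 for variables, 2 for constants, 3 for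
  successors. Two tails of the tag are therefore non-nil for a successor only, one tail separates
  constants from variables, and the tag itself is nil for \<infinity> only.\<close>

definition SUCCP :: "nat \<Rightarrow> exp" where
  "SUCCP r = TL (TL (HD (X r)))"

lemma exp_cost_SUCCP [simp]: "exp_cost (SUCCP r) = 4"
  by (simp add: SUCCP_def)

lemma eval_SUCCP [simp]: "eval_exp (SUCCP r) s = tl_tree (tl_tree (hd_tree (s r)))"
  by (simp add: SUCCP_def)

definition STRIP :: "nat \<Rightarrow> com" where
  "STRIP r = WHILE (SUCCP r) (ASSIGN r (TL (X r)))"

lemma runs_STRIP:
  "s r = code_sz a \<Longrightarrow> runs (STRIP r) s Q = Q (8 * height a + 5) (s(r := code_sz (base a)))"
proof (induction a arbitrary: s Q)
  case (Var x)
  then show ?case unfolding STRIP_def by (simp add: runs_WHILE_false fun_upd_idem)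
next
  case (Con c)
  then show ?case unfolding STRIP_def by (simp add: runs_WHILE_false fun_upd_idem)
next
  case (Succ a)
  from Succ.prems show ?case
    unfolding STRIP_def
    by (simp add: runs_WHILE_true Succ.IH[unfolded STRIP_def] fun_upd_same del: fun_upd_apply)
qed

text \<open>Covers \<infinity>, and in the comparison the remains of a term from which too many
  successors were removed.\<close>

lemma runs_STRIP_leaf:
  "hd_tree (s r) = Nul \<Longrightarrow> runs (STRIP r) s Q = Q 5 s"
  unfolding STRIP_def by (simp add: runs_WHILE_false)


primrec code_env :: "('v, 'c) env \<Rightarrow> ('v + 'c) tree" where
  "code_env [] = Nul"
| "code_env (p # U) = Pair (Pair (Atom (Inl (fst p))) (code_sz (snd p))) (code_env U)"

definition LOOKUP_LOOP :: com where
  "LOOKUP_LOOP = WHILE (X 8) (IF (ATOM_EQ (TL (X 5)) (HD (HD (X 8))))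
     (SEQ (ASSIGN 6 (TL (HD (X 8)))) (ASSIGN 8 NIL)) (ASSIGN 8 (TL (X 8))))"

text \<open>Register 6 starts with the code of \<infinity>, which is thus the answer for an unlisted
  variable. If the base is \<infinity>, the tail of register 5 is nil, matches no atom, and the
  default stays as well.\<close>

lemma runs_LOOKUP_LOOP:
  assumes "s 8 = code_env U" "s 6 = Pair Nul Nul"
    and "tl_tree (s 5) = Atom (Inl x) \<and> r = env U x \<or> tl_tree (s 5) = Nul \<and> r = Infty"
  shows "runs LOOKUP_LOOP s
    (\<lambda>t s'. t \<le> 16 * length U + 2 \<and> s' = s(6 := code_xsz r, 8 := Nul))"
  using assms
proof (induction U arbitrary: s)
  case Nil
  then show ?case by (auto simp: LOOKUP_LOOP_def runs_WHILE_false fun_upd_idem)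
next
  case (Cons p U)
  obtain y u where p: "p = (y, u)" by force
  have ne: "eval_exp (X 8) s \<noteq> Nul" using Cons.prems by simp
  show ?case
  proof (cases "tl_tree (s 5) = Atom (Inl y)")
    case True
    with Cons.prems p show ?thesis
      unfolding LOOKUP_LOOP_def
      by (auto simp: runs_WHILE_true[OF ne] true_tree_def runs_WHILE_false)
  next
    case False
    let ?s = "s(8 := code_env U)"
    have "runs LOOKUP_LOOP ?s
        (\<lambda>t s'. t \<le> 16 * length U + 2 \<and> s' = ?s(6 := code_xsz r, 8 := Nul))"
      by (rule Cons.IH) (use Cons.prems False p in auto)
    then have "runs LOOKUP_LOOP ?s
        (\<lambda>t s'. t + 12 \<le> 16 * length (p # U) + 2 \<and> s' = s(6 := code_xsz r, 8 := Nul))"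
      by (rule runs_mono) (auto simp: fun_eq_iff)
    moreover have "runs LOOKUP_LOOP s Q = runs LOOKUP_LOOP ?s (\<lambda>t. Q (t + 12))" for Q
      unfolding LOOKUP_LOOP_def using Cons.prems False p
      by (auto simp: runs_WHILE_true[OF ne]; simp add: numeral_eq_Suc)
    ultimately show ?thesis by (simp only:)
  qed
qed

definition ADD :: com where
  "ADD = WHILE (SUCCP 4) (SEQ
     (ASSIGN 7 (CONS (CONS NIL (CONS NIL (CONS NIL NIL))) (X 7))) (ASSIGN 4 (TL (X 4))))"

lemma runs_ADD:
  "s 4 = code_sz a \<Longrightarrow> s 7 = code_sz v \<Longrightarrow> runs ADD s Q =
    Q (19 * height a + 5) (s(4 := code_sz (base a), 7 := code_sz ((Succ ^^ height a) v)))"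
proof (induction a arbitrary: s v Q)
  case (Succ a)
  let ?s = "s(7 := code_sz (Succ v), 4 := code_sz a)"
  have "runs ADD s Q = runs ADD ?s (\<lambda>t. Q (t + 19))"
    unfolding ADD_def using Succ.prems by (simp add: runs_WHILE_true add.commute)
  also have "\<dots> = Q (19 * height a + 5 + 19)
      (?s(4 := code_sz (base a), 7 := code_sz ((Succ ^^ height a) (Succ v))))"
    by (rule Succ.IH) simp_all
  also have "?s(4 := code_sz (base a), 7 := code_sz ((Succ ^^ height a) (Succ v))) =
      s(4 := code_sz (base (Succ a)), 7 := code_sz ((Succ ^^ height (Succ a)) v))"
    by (simp add: fun_eq_iff funpow_swap1)
  also have "19 * height a + 5 + 19 = 19 * height (Succ a) + 5" by simp
  finally show ?case .
qed (simp_all add: ADD_def runs_WHILE_false fun_upd_idem)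

text \<open>The first test singles out constants, which are their own value; variables and
  \<infinity> go through the lookup. The successors of register 4 are added to finite values
  only.\<close>

definition EVAL :: com where
  "EVAL = SEQ (ASSIGN 5 (X 4)) (SEQ (STRIP 5) (SEQ
     (IF (TL (HD (X 5))) (ASSIGN 6 (X 5))
       (SEQ (ASSIGN 6 (CONS NIL NIL)) (SEQ (ASSIGN 8 (X 2)) LOOKUP_LOOP)))
     (SEQ (ASSIGN 7 (X 6)) (IF (HD (X 7)) ADD SKIP))))"

definition agree_except :: "nat set \<Rightarrow> 'a store \<Rightarrow> 'a store \<Rightarrow> bool" where
  "agree_except A s s' \<longleftrightarrow> (\<forall>i. i \<notin> A \<longrightarrow> s' i = s i)"

text \<open>Registers 5 and 6 belong to the result because \<open>UPDATE\<close> needs the variable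
  on the left and its current bound.\<close>

lemma runs_EVAL:
  fixes a :: "('v, 'c) xsz"
  assumes s4: "s 4 = code_xsz a" and s2: "s 2 = code_env U"
  shows "runs EVAL s (\<lambda>t s'. t \<le> 27 * xheight a + 16 * length U + 60 \<and>
    s' 5 = code_xsz (xbase a) \<and> s' 6 = code_xsz (apply_xsz (env U) (xbase a)) \<and>
    s' 7 = code_xsz (apply_xsz (env U) a) \<and> agree_except {4..8} s s')"
proof (cases a)
  case Infty
  show ?thesis
    unfolding EVAL_def using s4 s2 Infty
    apply (simp add: runs_STRIP_leaf)
    apply (rule runs_mono[OF runs_LOOKUP_LOOP[where U = U and r = Infty]])
       apply (auto simp: agree_except_def)
    done
next
  case (Fin b)
  have base_cases: "(\<exists>x. base b = Var x) \<or> (\<exists>c. base b = Con c)" by (induction b) auto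
  show ?thesis
  proof (cases "\<exists>c. base b = Con c")
    case True
    then obtain c where c: "base b = Con c" by blast
    have "apply_sz (env U) b = Fin ((Succ ^^ height b) (Con c))"
      by (subst apply_sz_base) (simp add: c)
    then show ?thesis
      unfolding EVAL_def using s4 s2 Fin c
      by (simp add: runs_STRIP[where a = b] runs_ADD[where a = b and v = "Con c"])
        (auto simp: agree_except_def)
  next
    case False
    with base_cases obtain x where x: "base b = Var x" by blast
    have ap: "apply_sz (env U) b =
        (case env U x of Fin t \<Rightarrow> Fin ((Succ ^^ height b) t) | Infty \<Rightarrow> Infty)"
      by (subst apply_sz_base) (simp add: x)
    show ?thesis
      unfolding EVAL_def using s4 s2 Fin x
      apply (simp add: runs_STRIP[where a = b])
      apply (rule runs_mono[OF runs_LOOKUP_LOOP[where U = U and r = "env U x" and x = x]])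
         apply (auto simp: agree_except_def)[3]
      apply (elim conjE)
      apply (cases "env U x")
      subgoal for t s' u
        by (cases u) (auto simp: runs_ADD[where a = b and v = u] ap agree_except_def)
      subgoal for t s'
        by (auto simp: ap agree_except_def)
      done
  qed
qed

text \<open>If the left-hand side has more successors, then register 11 runs past its constant and ends up
  as an atom or nil, whose tail is nil and hence different from every atom.\<close>

definition PEEL :: com where
  "PEEL = WHILE (SUCCP 7) (SEQ (ASSIGN 7 (TL (X 7))) (ASSIGN 11 (TL (X 11))))"

lemma runs_PEEL:
  "s 7 = code_sz a \<Longrightarrow> runs PEEL s Q =
    Q (12 * height a + 5) (s(7 := code_sz (base a), 11 := (tl_tree ^^ height a) (s 11)))"
proof (induction a arbitrary: s Q)
  case (Succ a)
  let ?s = "s(7 := code_sz a, 11 := tl_tree (s 11))"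
  have "runs PEEL s Q = runs PEEL ?s (\<lambda>t. Q (t + 12))"
    unfolding PEEL_def using Succ.prems by (simp add: runs_WHILE_true add.commute)
  also have "\<dots> = Q (12 * height a + 5 + 12)
      (?s(7 := code_sz (base a), 11 := (tl_tree ^^ height a) (?s 11)))"
    by (rule Succ.IH) simp
  also have "?s(7 := code_sz (base a), 11 := (tl_tree ^^ height a) (?s 11)) =
      s(7 := code_sz (base (Succ a)), 11 := (tl_tree ^^ height (Succ a)) (s 11))"
    by (simp add: fun_eq_iff funpow_swap1)
  also have "12 * height a + 5 + 12 = 12 * height (Succ a) + 5" by simp
  finally show ?case .
qed (simp_all add: PEEL_def runs_WHILE_false fun_upd_idem)

lemma funpow_tl_tree_code_le:
  "k \<le> height a \<Longrightarrow>
    \<exists>b. (tl_tree ^^ k) (code_sz a) = code_sz b \<and> base b = base a \<and> height b \<le> height a"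
proof (induction k arbitrary: a)
  case (Suc k)
  then obtain a' where a': "a = Succ a'" by (cases a) auto
  from Suc.IH[of a'] Suc.prems a' show ?case by (fastforce simp: funpow_swap1)
qed auto

lemma funpow_tl_tree_Nul: "(tl_tree ^^ k) Nul = Nul"
  by (induction k) auto

lemma funpow_tl_tree_code_gt:
  "height a < k \<Longrightarrow> hd_tree ((tl_tree ^^ k) (code_sz a)) = Nul \<and>
     tl_tree ((tl_tree ^^ k) (code_sz a)) = Nul"
proof (induction k arbitrary: a)
  case (Suc k)
  show ?case
  proof (cases a)
    case (Succ a')
    with Suc show ?thesis by (simp add: funpow_swap1)
  qed (cases k; simp add: funpow_swap1 funpow_tl_tree_Nul)+
qed simp

definition CMP :: com where
  "CMP = SEQ (ASSIGN 11 (X 9)) (SEQ (ASSIGN 12 (CONS NIL NIL))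
     (IF (HD (X 9))
       (IF (HD (X 7))
         (SEQ PEEL (SEQ (STRIP 11) (ASSIGN 12 (ATOM_EQ (TL (X 7)) (TL (X 11))))))
         (ASSIGN 12 NIL))
       SKIP))"

lemma code_sz_hd: "hd_tree (code_sz a) \<noteq> Nul"
  by (cases a) auto

text \<open>Ground finite values end in constants, so \<open>preceq_iff_base_height\<close> applies:
  once the right-hand side has lost as many successors as the left-hand side has, the order holds
  iff the same constant is found below what remains.\<close>

lemma runs_CMP:
  fixes a b :: "('v, 'c) xsz"
  assumes s7: "s 7 = code_xsz a" and s9: "s 9 = code_xsz b"
    and a: "vars_xsz a = {}" and b: "vars_xsz b = {}"
  shows "runs CMP s (\<lambda>t s'. t \<le> 12 * xheight a + 8 * xheight b + 60 \<and>
    (s' 12 \<noteq> Nul \<longleftrightarrow> a \<preceq>\<^sub>\<infinity> b) \<and> agree_except {7, 11, 12} s s')"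
proof (cases b)
  case Infty
  with s9 show ?thesis unfolding CMP_def by (auto simp: agree_except_def)
next
  case (Fin v)
  note v = this
  show ?thesis
  proof (cases a)
    case Infty
    with s7 s9 v show ?thesis unfolding CMP_def by (auto simp: agree_except_def code_sz_hd)
  next
    case (Fin u)
    obtain c where c: "base u = Con c" using ground_base a Fin by fastforce
    obtain d where d: "base v = Con d" using ground_base b v by fastforce
    show ?thesis
    proof (cases "height u \<le> height v")
      case True
      obtain w where w: "(tl_tree ^^ height u) (code_sz v) = code_sz w" "base w = base v"
          "height w \<le> height v"
        using funpow_tl_tree_code_le[OF True] by blast
      show ?thesis
        unfolding CMP_def using s7 s9 v Fin c d w True
        by (simp add: code_sz_hd runs_PEEL[where a = u] runs_STRIP[where a = w])
          (auto simp: agree_except_def preceq_iff_base_height true_tree_def)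
    next
      case False
      then have gt: "height v < height u" by simp
      show ?thesis
        unfolding CMP_def using s7 s9 v Fin c d gt funpow_tl_tree_code_gt[OF gt]
        by (simp add: code_sz_hd runs_PEEL[where a = u] runs_STRIP_leaf)
          (auto simp: agree_except_def preceq_iff_base_height true_tree_def)
    qed
  qed
qed


section \<open>Lowering the bound at a violated constraint\<close>

section \<open>One step of the iteration\<close>

text \<open>The first finite bound is the full value of \<open>b\<close>; the successors of
  \<open>a\<close> are not subtracted, since later violations lower the bound one by one.
  \<open>None\<close> is meaningful for violated constraints only.\<close>

definition refine ::
  "('v, 'c) env \<Rightarrow> ('v, 'c) xsz \<Rightarrow> ('v, 'c) xsz \<Rightarrow> ('v, 'c) env option" where
  "refine U a b = (case xbase a of
     Fin (Var x) \<Rightarrow>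
       (case env U x of
          Infty \<Rightarrow> (case apply_xsz (env U) b of Fin r \<Rightarrow> Some ((x, r) # U) | Infty \<Rightarrow> None)
        | Fin t \<Rightarrow> (case t of Succ t' \<Rightarrow> Some ((x, t') # U) | _ \<Rightarrow> None))
   | _ \<Rightarrow> None)"

text \<open>No condition on the domain is imposed, so that \<open>env U\<close>, which is
  \<infinity> on all unlisted variables, can qualify.\<close>

definition satisfies :: "('v, 'c) subst \<Rightarrow> ('v, 'c) constraint \<Rightarrow> bool" where
  "satisfies \<phi> k \<longleftrightarrow> apply_xsz \<phi> (fst k) \<preceq>\<^sub>\<infinity> apply_xsz \<phi> (snd k)"

text \<open>The value of \<open>a\<close> under \<open>\<phi>\<close> lies below the finite value of
  \<open>b\<close> under \<open>env U\<close>. A constant base would make the constraint hold under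
  \<open>env U\<close> too, and \<infinity> is excluded, so the base is a variable. Hence
  \<open>None\<close> shows that no \<open>\<phi>\<close> below \<open>env U\<close> satisfies the
  constraint.\<close>

lemma refine_upper_bound:
  assumes upper: "\<And>x. \<phi> x \<preceq>\<^sub>\<infinity> env U x"
    and sat: "satisfies \<phi> (a, b)" and viol: "\<not> satisfies (env U) (a, b)"
  shows "\<exists>U'. refine U a b = Some U' \<and> (\<forall>x. \<phi> x \<preceq>\<^sub>\<infinity> env U' x)"
proof -
  have le: "apply_xsz \<phi> a \<preceq>\<^sub>\<infinity> apply_xsz (env U) b"
    using sat apply_xsz_mono[of b \<phi> "env U"] upper preceq_inf_trans
    unfolding satisfies_def by fastforce
  have nle: "\<not> apply_xsz (env U) a \<preceq>\<^sub>\<infinity> apply_xsz (env U) b"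
    using viol by (simp add: satisfies_def)
  obtain r where r: "apply_xsz (env U) b = Fin r"
    using nle by (cases "apply_xsz (env U) b") auto
  obtain u where u: "apply_xsz \<phi> a = Fin u" "u \<preceq> r"
    using le r by (cases "apply_xsz \<phi> a") auto
  obtain a0 where a0: "a = Fin a0" using u by (cases a) auto
  show ?thesis
  proof (cases "base a0")
    case (Con c)
    then have "apply_sz (env U) a0 = apply_sz \<phi> a0"
      by (subst (1 2) apply_sz_base) simp
    with le nle a0 show ?thesis by simp
  next
    case (Succ a')
    then show ?thesis by simp
  next
    case (Var x)
    have ap: "apply_sz \<psi> a0 =
        (case \<psi> x of Fin t \<Rightarrow> Fin ((Succ ^^ height a0) t) | Infty \<Rightarrow> Infty)" for \<psi>
      by (subst apply_sz_base) (simp add: Var)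
    obtain w where w: "\<phi> x = Fin w" "u = (Succ ^^ height a0) w"
      using u(1) a0 ap[of \<phi>] by (cases "\<phi> x") auto
    then have wu: "w \<preceq> u" by (auto simp: preceq_iff_funpow)
    show ?thesis
    proof (cases "env U x")
      case Infty
      then show ?thesis
        using a0 Var r upper w preceq_trans[OF wu u(2)] by (auto simp: refine_def)
    next
      case (Fin t)
      have wt: "w \<preceq> t" using upper[of x] w Fin by simp
      \<comment> \<open>With equality, \<open>a\<close> would have the same value under both
        substitutions, and the constraint would not be violated.\<close>
      have "w \<noteq> t"
        using nle u w r a0 ap[of "env U"] Fin by auto
      moreover obtain k where "t = (Succ ^^ k) w" using wt by (auto simp: preceq_iff_funpow)
      ultimately obtain t' where t': "t = Succ t'" "w \<preceq> t'"
        by (cases k) (auto simp: preceq_iff_funpow)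
      then show ?thesis using a0 Var Fin upper w by (auto simp: refine_def)
    qed
  qed
qed

definition FAIL :: com where
  "FAIL = SEQ (ASSIGN 0 NIL) (ASSIGN 3 NIL)"

text \<open>A satisfied constraint is skipped, while every change of the bound restarts the scan.
  The tail of a successor code is its predecessor. If register 6 holds \<infinity>, the head of
  register 5 tells an unbounded variable from a left-hand side \<infinity>.\<close>

definition UPDATE :: com where
  "UPDATE = IF (X 12) (ASSIGN 3 (TL (X 3)))
     (IF (SUCCP 6) (SEQ (ASSIGN 2 (CONS (CONS (TL (X 5)) (TL (X 6))) (X 2))) (ASSIGN 3 (X 1)))
       (IF (HD (X 6)) FAIL
         (IF (HD (X 5))
           (SEQ (ASSIGN 2 (CONS (CONS (TL (X 5)) (X 9)) (X 2))) (ASSIGN 3 (X 1)))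
           FAIL)))"

lemma runs_UPDATE_satisfied:
  "s 12 \<noteq> Nul \<Longrightarrow> runs UPDATE s (\<lambda>t s'. t \<le> 60 \<and> s' = s(3 := tl_tree (s 3)))"
  by (simp add: UPDATE_def)

lemma runs_UPDATE_violated:
  assumes "s 12 = Nul" "s 2 = code_env U" "s 5 = code_xsz (xbase a)"
    and "s 6 = code_xsz (apply_xsz (env U) (xbase a))" "s 9 = code_xsz (apply_xsz (env U) b)"
    and fin: "apply_xsz (env U) b \<noteq> Infty" and gr: "ground_env U"
  shows "runs UPDATE s (\<lambda>t s'. t \<le> 60 \<and> (case refine U a b of
      None \<Rightarrow> s' = s(0 := Nul, 3 := Nul)
    | Some U' \<Rightarrow> s' = s(2 := code_env U', 3 := s 1)))"
proof (cases a)
  case Infty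
  with assms show ?thesis by (simp add: UPDATE_def FAIL_def refine_def)
next
  case (Fin a0)
  show ?thesis
  proof (cases "base a0")
    case (Con c)
    with assms Fin show ?thesis by (simp add: UPDATE_def FAIL_def refine_def)
  next
    case (Succ a')
    then show ?thesis by simp
  next
    case (Var x)
    obtain r where r: "apply_xsz (env U) b = Fin r" using fin by (cases "apply_xsz (env U) b") auto
    show ?thesis
    proof (cases "env U x")
      case Infty
      with assms Fin Var r show ?thesis by (simp add: UPDATE_def FAIL_def refine_def)
    next
      case (Fin t)
      with assms \<open>a = Fin a0\<close> Var r env_ground[OF gr Fin] show ?thesis
        by (cases t) (simp_all add: UPDATE_def FAIL_def refine_def)
    qed
  qed
qed

text \<open>The right-hand side is evaluated first, so that registers 5 to 7 finally describe the
  left-hand side.\<close>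

definition BODY :: com where
  "BODY = SEQ (ASSIGN 4 (TL (HD (X 3)))) (SEQ EVAL (SEQ (ASSIGN 9 (X 7))
     (SEQ (ASSIGN 4 (HD (HD (X 3)))) (SEQ EVAL (SEQ CMP UPDATE)))))"

lemma height_apply_xsz_env:
  assumes "\<forall>(x, t) \<in> set U. height t \<le> B"
  shows "xheight (apply_xsz (env U) a) \<le> xheight a + B"
proof (cases a)
  case (Fin b)
  show ?thesis
  proof (cases "apply_sz (env U) b")
    case t: (Fin t)
    have "height t \<le> height b + B"
      by (rule height_apply_sz[OF t]) (use assms in \<open>auto dest: env_in_set\<close>)
    with Fin t show ?thesis by simp
  qed (simp add: Fin)
qed simp

text \<open>The bound adds two evaluations, each \<open>27 * n + 16 * length U\<close>, and one
  comparison of values of height at most \<open>n + B\<close>, which costs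
  \<open>20 * (n + B)\<close>, up to constants.\<close>

lemma runs_BODY:
  fixes a b :: "('v, 'c) xsz"
  assumes s2: "s 2 = code_env U" and s3: "s 3 = code_list ((a, b) # p)"
    and gr: "ground_env U" and B: "\<forall>(x, t) \<in> set U. height t \<le> B"
    and a: "xheight a \<le> n" and b: "xheight b \<le> n"
  shows "runs BODY s (\<lambda>t s'. t \<le> 74 * n + 32 * length U + 20 * B + 300 \<and> s' 1 = s 1 \<and>
    (if satisfies (env U) (a, b) then s' 0 = s 0 \<and> s' 2 = s 2 \<and> s' 3 = code_list p
     else (case refine U a b of
        None \<Rightarrow> s' 0 = Nul \<and> s' 3 = Nul
      | Some U' \<Rightarrow> s' 0 = s 0 \<and> s' 2 = code_env U' \<and> s' 3 = s 1)))" (is "runs BODY s ?Q")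
proof -
  let ?A = "apply_xsz (env U) a" and ?R = "apply_xsz (env U) b"
  have gA: "vars_xsz ?A = {}" using apply_xsz_env_ground[OF gr, of a] by (cases ?A) auto
  have gR: "vars_xsz ?R = {}" using apply_xsz_env_ground[OF gr, of b] by (cases ?R) auto
  have hA: "xheight ?A \<le> n + B" using height_apply_xsz_env[OF B, of a] a by simp
  have hR: "xheight ?R \<le> n + B" using height_apply_xsz_env[OF B, of b] b by simp
  define s1 where "s1 = s(4 := code_xsz b)"
  \<comment> \<open>The run is assembled from its last command backwards; \<open>T\<close> stands
    for the time already spent.\<close>
  have upd: "runs UPDATE s5 (\<lambda>t5 s6. ?Q (t5 + T) s6)"
    if s5: "s5 12 \<noteq> Nul \<longleftrightarrow> ?A \<preceq>\<^sub>\<infinity> ?R" "s5 5 = code_xsz (xbase a)"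
      "s5 6 = code_xsz (apply_xsz (env U) (xbase a))" "s5 9 = code_xsz ?R"
      "s5 0 = s 0" "s5 1 = s 1" "s5 2 = s 2" "s5 3 = s 3"
      and T: "T \<le> 74 * n + 32 * length U + 20 * B + 240" for s5 T
  proof (cases "?A \<preceq>\<^sub>\<infinity> ?R")
    case True
    then have "s5 12 \<noteq> Nul" using s5 by simp
    then show ?thesis
      by (rule runs_mono[OF runs_UPDATE_satisfied]) (use True T s5 s3 in \<open>auto simp: satisfies_def\<close>)
  next
    case False
    then have f: "?R \<noteq> Infty" by auto
    show ?thesis
      by (rule runs_mono[OF runs_UPDATE_violated[where U = U and a = a and b = b]])
        (use False f T s5 s2 gr in \<open>auto simp: satisfies_def split: option.splits\<close>)
  qed
  have cmp: "runs CMP s4 (\<lambda>t4 s5. runs UPDATE s5 (\<lambda>t5. ?Q (t5 + (T + t4))))"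
    if s4: "s4 7 = code_xsz ?A" "s4 5 = code_xsz (xbase a)"
      "s4 6 = code_xsz (apply_xsz (env U) (xbase a))" "s4 9 = code_xsz ?R"
      "s4 0 = s 0" "s4 1 = s 1" "s4 2 = s 2" "s4 3 = s 3"
      and T: "T \<le> 54 * n + 32 * length U + 180" for s4 T
  proof (rule runs_mono[OF runs_CMP[OF s4(1,4) gA gR]], elim conjE)
    fix t4 s5
    assume t4: "t4 \<le> 12 * xheight ?A + 8 * xheight ?R + 60"
      and "(s5 12 \<noteq> Nul) = (?A \<preceq>\<^sub>\<infinity> ?R)" "agree_except {7, 11, 12} s4 s5"
    then show "runs UPDATE s5 (\<lambda>t5. ?Q (t5 + (T + t4)))"
      by (intro upd) (use s4 T t4 hA hR in \<open>auto simp: agree_except_def\<close>)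
  qed
  have evA: "runs EVAL r (\<lambda>t3 s4. runs CMP s4 (\<lambda>t4 s5. runs UPDATE s5
      (\<lambda>t5. ?Q (t5 + (T + t3 + t4)))))"
    if r: "r 4 = code_xsz a" "r 9 = code_xsz ?R" "r 0 = s 0" "r 1 = s 1" "r 2 = s 2" "r 3 = s 3"
      and T: "T \<le> 27 * n + 16 * length U + 120" for r T
  proof (rule runs_mono[OF runs_EVAL[of r a U]], goal_cases)
    case (3 t3 s4)
    then show ?case
      by (intro cmp) (use r T a in \<open>auto simp: agree_except_def\<close>)
  qed (use r s2 in auto)
  have "runs EVAL s1 (\<lambda>t1 s2. runs EVAL (s2(9 := s2 7, 4 := code_xsz a))
    (\<lambda>t3 s4. runs CMP s4 (\<lambda>t4 s5. runs UPDATE s5 (\<lambda>t5. ?Q (t5 + ((t1 + 20) + t3 + t4)))))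
      \<and> s2 3 = s 3)"
  proof (rule runs_mono[OF runs_EVAL[of s1 b U]], goal_cases)
    case (3 t1 r)
    then show ?case
      by (intro conjI evA) (use b in \<open>auto simp: agree_except_def s1_def\<close>)
  qed (use s2 in \<open>auto simp: s1_def\<close>)
  then have "runs EVAL s1 (\<lambda>t1 s2. runs EVAL (s2(9 := s2 7, 4 := hd_tree (hd_tree (s2 3))))
    (\<lambda>t3 s4. runs CMP s4 (\<lambda>t4 s5. runs UPDATE s5 (\<lambda>t5. ?Q (18 + t1 + t3 + t4 + t5)))))"
    apply (rule runs_mono)
    apply (elim conjE)
    apply (simp only: s3 code_list.simps hd_tree.simps fst_conv)
    apply (erule runs_mono)+
    apply auto
    done
  then show ?thesis
    unfolding BODY_def s1_def using s3
    apply simp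
    apply (erule runs_mono)+
    apply simp
    done
qed


section \<open>Termination and running time of the main loop\<close>

section \<open>The iteration\<close>

text \<open>\<open>M\<close> will exceed the height of every finite bound, so replacing \<infinity>
  by a finite bound also lowers the weight.\<close>

definition weight :: "nat \<Rightarrow> ('v, 'c) xsz \<Rightarrow> nat" where
  "weight M a = (case a of Fin t \<Rightarrow> height t | Infty \<Rightarrow> M)"

definition potential :: "'v set \<Rightarrow> nat \<Rightarrow> ('v, 'c) env \<Rightarrow> nat" where
  "potential V M U = (\<Sum>x \<in> V. weight M (env U x))"

lemma potential_Cons_less:
  assumes "finite V" "x \<in> V" "height t < weight M (env U x)"
  shows "potential V M ((x, t) # U) < potential V M U"
  unfolding potential_def
  using assms by (intro sum_strict_mono_ex1) (auto simp: weight_def)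

text \<open>The third conjunct is stated with the number of variables already bounded, since only the first
  bound of a variable can be higher than those present.\<close>

definition bounded_env :: "'v set \<Rightarrow> nat \<Rightarrow> ('v, 'c) env \<Rightarrow> bool" where
  "bounded_env V n U \<longleftrightarrow> ground_env U \<and> fst ` set U \<subseteq> V \<and>
     (\<forall>(x, t) \<in> set U. height t \<le> n * card (fst ` set U)) \<and>
     length U + potential V (n * card V + 1) U \<le> card V * (n * card V + 1)"

lemma bounded_env_height:
  assumes "finite V" "bounded_env V n U" "(x, t) \<in> set U"
  shows "height t \<le> n * card V"
proof -
  have "card (fst ` set U) \<le> card V"
    using assms unfolding bounded_env_def by (auto intro: card_mono)
  then show ?thesis
    using assms unfolding bounded_env_def
    by (metis (no_types, lifting) case_prodD le_trans mult_le_mono2)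
qed

lemma bounded_env_Nil: "bounded_env V n []"
  by (simp add: bounded_env_def ground_env_def potential_def weight_def)

lemma vars_base: "vars_sz (base a) = vars_sz a"
  by (induction a) auto

text \<open>The new entry adds one to the length and takes at least one from the potential, which
  keeps their sum below the initial potential.\<close>

lemma bounded_env_Cons:
  assumes V: "finite V" "x \<in> V" and U: "bounded_env V n U"
    and t: "vars_sz t = {}" "height t < weight (n * card V + 1) (env U x)"
      "height t \<le> n * card (insert x (fst ` set U))"
  shows "bounded_env V n ((x, t) # U)"
proof -
  have "card (fst ` set U) \<le> card (insert x (fst ` set U))"
    by (simp add: card_insert_le)
  then have mono: "n * card (fst ` set U) \<le> n * card (insert x (fst ` set U))"
    by simp
  have "height u \<le> n * card (insert x (fst ` set U))" if "(y, u) \<in> set U" for y u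
    using U that le_trans[OF _ mono] unfolding bounded_env_def by blast
  then have "\<forall>(y, u) \<in> set ((x, t) # U). height u \<le> n * card (fst ` set ((x, t) # U))"
    using t(3) by auto
  moreover have "length ((x, t) # U) + potential V (n * card V + 1) ((x, t) # U) \<le>
      card V * (n * card V + 1)"
    using potential_Cons_less[OF V t(2)] U unfolding bounded_env_def by simp
  ultimately show ?thesis
    using U V t unfolding bounded_env_def ground_env_def by simp
qed

text \<open>A first bound for \<open>x\<close> exceeds the present ones by at most \<open>n\<close>,
  and the number of bounded variables grows by one. Otherwise \<open>x\<close> is already counted
  and its bound shrinks.\<close>

lemma refine_bounded:
  assumes V: "finite V" "vars_xsz a \<subseteq> V" and U: "bounded_env V n U"
    and b: "xheight b \<le> n" and U': "refine U a b = Some U'"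
  shows "bounded_env V n U' \<and>
    potential V (n * card V + 1) U' < potential V (n * card V + 1) U"
proof -
  obtain a0 x where a: "a = Fin a0" "base a0 = Var x"
    using U' by (cases a) (auto simp: refine_def split: sz.splits)
  have x: "x \<in> V" using V a vars_base[of a0] by auto
  have gr: "ground_env U" using U by (simp add: bounded_env_def)
  have "\<exists>t. U' = (x, t) # U \<and> vars_sz t = {} \<and> height t < weight (n * card V + 1) (env U x) \<and>
      height t \<le> n * card (insert x (fst ` set U))"
  proof (cases "env U x")
    case Infty
    then obtain t where t: "apply_xsz (env U) b = Fin t" "U' = (x, t) # U"
      using U' a by (auto simp: refine_def split: xsz.splits)
    have nin: "x \<notin> fst ` set U"
      using Infty by (auto simp: env_def split: option.splits simp: map_of_eq_None_iff)
    have "\<forall>(x, t) \<in> set U. height t \<le> n * card (fst ` set U)"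
      using U by (simp add: bounded_env_def)
    from height_apply_xsz_env[OF this, of b] b t nin
    have h: "height t \<le> n * card (insert x (fst ` set U))" by simp
    have "card (insert x (fst ` set U)) \<le> card V"
      using U x V by (intro card_mono) (auto simp: bounded_env_def)
    then have "n * card (insert x (fst ` set U)) \<le> n * card V" by simp
    with h have "height t \<le> n * card V" by (rule le_trans)
    then show ?thesis
      using t h Infty apply_xsz_env_ground[OF gr t(1)] by (simp add: weight_def)
  next
    case (Fin u)
    then obtain t where t: "u = Succ t" "U' = (x, t) # U"
      using U' a by (auto simp: refine_def split: sz.splits)
    have mem: "(x, u) \<in> set U" by (rule env_in_set[OF Fin])
    then have "insert x (fst ` set U) = fst ` set U" by force
    moreover have "height u \<le> n * card (fst ` set U)"
      using mem U unfolding bounded_env_def by auto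
    ultimately show ?thesis
      using t Fin env_ground[OF gr Fin] by (simp add: weight_def)
  qed
  then show ?thesis
    using bounded_env_Cons[OF V(1) x U] potential_Cons_less[OF V(1) x] by blast
qed

text \<open>Nil encodes \<open>Bot\<close> and is already the answer no. Any other input is non-nil
  and stays in register 0 as the answer yes unless \<open>FAIL\<close> erases it. Register 2 is
  initially nil, the code of the empty environment.\<close>

definition SOLVE :: com where
  "SOLVE = IF (X 0) (SEQ (ASSIGN 1 (TL (X 0))) (SEQ (ASSIGN 3 (X 1)) (WHILE (X 3) BODY))) SKIP"

text \<open>The bound of \<open>runs_BODY\<close> for at most \<open>n * (n * n + 1)\<close> entries
  of height at most \<open>n * n\<close>.\<close>

definition body_time :: "nat \<Rightarrow> nat" where
  "body_time n = 74 * n + 32 * (n * (n * n + 1)) + 20 * (n * n) + 300"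

text \<open>Bounds the initial loop measure, with at most \<open>n\<close> variables and
  \<open>n\<close> constraints.\<close>

definition iterations :: "nat \<Rightarrow> nat" where
  "iterations n = n * (n * n + 1) * (n + 1) + n"

text \<open>The list splits into constraints \<open>pre\<close> checked under the current bound and
  \<open>p\<close> still to be checked. The measure is lexicographic: a drop of the potential by one
  is worth \<open>length ks + 1\<close>, more than the restarted scan costs.\<close>

definition solve_inv :: "('v, 'c) constraint list \<Rightarrow> 'v set \<Rightarrow> nat \<Rightarrow> nat \<Rightarrow> ('v + 'c) store \<Rightarrow> bool"
where
  "solve_inv ks V n m s \<longleftrightarrow> s 1 = code_list ks \<and>
     (s 0 = Nul \<and> s 3 = Nul \<and> \<not> (\<exists>\<phi>. \<forall>k \<in> set ks. satisfies \<phi> k) \<or>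
      s 0 \<noteq> Nul \<and> (\<exists>U pre p. bounded_env V n U \<and>
        (\<forall>\<phi>. (\<forall>k \<in> set ks. satisfies \<phi> k) \<longrightarrow> (\<forall>x. \<phi> x \<preceq>\<^sub>\<infinity> env U x)) \<and>
        s 2 = code_env U \<and> s 3 = code_list p \<and> ks = pre @ p \<and> (\<forall>k \<in> set pre. satisfies (env U) k) \<and>
        m = potential V (n * card V + 1) U * (length ks + 1) + length p))"

lemma solve_inv_BODY:
  assumes V: "finite V" "card V \<le> n" "\<And>a b. (a, b) \<in> set ks \<Longrightarrow> vars_xsz a \<union> vars_xsz b \<subseteq> V"
    and h: "\<And>a b. (a, b) \<in> set ks \<Longrightarrow> xheight a \<le> n \<and> xheight b \<le> n"
    and inv: "solve_inv ks V n m s" and ne: "s 3 \<noteq> Nul"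
  shows "runs BODY s (\<lambda>t s'. t \<le> body_time n \<and> (\<exists>m'<m. solve_inv ks V n m' s'))"
proof -
  let ?M = "n * card V + 1"
  from inv ne obtain U pre p where U: "bounded_env V n U"
    and up: "\<And>\<phi>. \<forall>k \<in> set ks. satisfies \<phi> k \<Longrightarrow> \<forall>x. \<phi> x \<preceq>\<^sub>\<infinity> env U x"
    and s: "s 0 \<noteq> Nul" "s 1 = code_list ks" "s 2 = code_env U" "s 3 = code_list p" "ks = pre @ p"
    and pre: "\<forall>k \<in> set pre. satisfies (env U) k"
    and m: "m = potential V ?M U * (length ks + 1) + length p"
    unfolding solve_inv_def by blast
  obtain a b p' where p: "p = (a, b) # p'" using s(4) ne by (cases p) auto
  have mem: "(a, b) \<in> set ks" using s p by simp
  have hb: "\<forall>(x, t) \<in> set U. height t \<le> n * card V"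
    using bounded_env_height[OF V(1) U] by blast
  have gr: "ground_env U" using U by (simp add: bounded_env_def)
  have nV: "n * card V \<le> n * n" using V by simp
  have "length U \<le> card V * ?M" using U by (simp add: bounded_env_def)
  also have "\<dots> \<le> n * (n * n + 1)" using V(2) nV by (intro mult_le_mono) auto
  finally have time: "74 * n + 32 * length U + 20 * (n * card V) + 300 \<le> body_time n"
    using nV unfolding body_time_def by linarith
  show ?thesis
  proof (rule runs_mono[OF runs_BODY[OF s(3) s(4)[unfolded p] gr hb, where n = n]], goal_cases)
    case 1 then show ?case using h[OF mem] by simp
  next
    case 2 then show ?case using h[OF mem] by simp
  next
    case (3 t s')
    have "\<exists>m'<m. solve_inv ks V n m' s'"
    proof (cases "satisfies (env U) (a, b)")
      case True
      have "solve_inv ks V n (potential V ?M U * (length ks + 1) + length p') s'"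
        unfolding solve_inv_def
        apply (intro conjI disjI2)
        subgoal using 3 s by simp
        subgoal using 3 s True by simp
        subgoal
          apply (rule exI[of _ U], rule exI[of _ "pre @ [(a, b)]"], rule exI[of _ p'])
          using 3 s p U up pre True by auto
        done
      then show ?thesis using m p by (intro exI conjI) auto
    next
      case False
      show ?thesis
      proof (cases "refine U a b")
        case None
        have "\<not> (\<exists>\<phi>. \<forall>k \<in> set ks. satisfies \<phi> k)"
        proof
          assume "\<exists>\<phi>. \<forall>k \<in> set ks. satisfies \<phi> k"
          then obtain \<phi> where "\<forall>k \<in> set ks. satisfies \<phi> k" by blast
          with refine_upper_bound[OF _ _ False, of \<phi>] up mem None show False by auto
        qed
        \<comment> \<open>After a failure the invariant leaves the measure free, and 0 is below
          \<open>m\<close> because the scan list was not empty.\<close>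
        then have "solve_inv ks V n 0 s'"
          using 3 s False None unfolding solve_inv_def by simp
        then show ?thesis using m p by (intro exI[of _ 0]) simp
      next
        case (Some U')
        have "vars_xsz a \<subseteq> V" using V(3)[OF mem] by blast
        from refine_bounded[OF V(1) this U _ Some] h[OF mem]
        have U': "bounded_env V n U'" "potential V ?M U' < potential V ?M U" by auto
        have up': "\<forall>x. \<phi> x \<preceq>\<^sub>\<infinity> env U' x" if "\<forall>k \<in> set ks. satisfies \<phi> k" for \<phi>
          using refine_upper_bound[OF _ _ False, of \<phi>] up[OF that] that mem Some by auto
        have "solve_inv ks V n (potential V ?M U' * (length ks + 1) + length ks) s'"
          unfolding solve_inv_def
          apply (intro conjI disjI2)
          subgoal using 3 s by simp
          subgoal using 3 s False Some by simp
          subgoal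
            apply (rule exI[of _ U'], rule exI[of _ "[]"], rule exI[of _ ks])
            using 3 s U' up' False Some by auto
          done
        moreover have "potential V ?M U' * (length ks + 1) + length ks < m"
        proof -
          have "(potential V ?M U' + 1) * (length ks + 1) \<le> potential V ?M U * (length ks + 1)"
            using U'(2) by (intro mult_le_mono1) simp
          then show ?thesis unfolding m by (simp add: algebra_simps)
        qed
        ultimately show ?thesis by blast
      qed
    qed
    then show ?case using 3 time by simp
  qed
qed

section \<open>From the loop to the decision problem\<close>

lemma finite_vars_sz: "finite (vars_sz a)"
  by (induction a) auto

lemma finite_vars_xsz: "finite (vars_xsz a)"
  by (cases a) (auto simp: finite_vars_sz)

text \<open>Resetting \<open>\<phi>\<close> to the identity outside the variables of the problem
  changes no constraint and gives an admissible, finite domain.\<close>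

lemma satisfiable_iff_satisfies:
  assumes "finite K"
  shows "satisfiable (Constraints K) \<longleftrightarrow> (\<exists>\<phi>. \<forall>k \<in> K. satisfies \<phi> k)"
proof
  assume "\<exists>\<phi>. \<forall>k \<in> K. satisfies \<phi> k"
  then obtain \<phi> where \<phi>: "\<forall>k \<in> K. satisfies \<phi> k" by blast
  let ?V = "vars_problem (Constraints K)"
  let ?\<psi> = "\<lambda>x. if x \<in> ?V then \<phi> x else Fin (Var x)"
  have fin: "finite ?V" using assms by (auto simp: finite_vars_xsz)
  have dom: "subst_dom ?\<psi> \<subseteq> ?V" by (auto simp: subst_dom_def)
  have "apply_xsz ?\<psi> a \<preceq>\<^sub>\<infinity> apply_xsz ?\<psi> b" if "(a, b) \<in> K" for a b
  proof -
    have "apply_xsz ?\<psi> a = apply_xsz \<phi> a" "apply_xsz ?\<psi> b = apply_xsz \<phi> b"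
      using that by (auto intro!: apply_xsz_cong)
    with \<phi> that show ?thesis by (auto simp: satisfies_def)
  qed
  then have "solution (Constraints K) ?\<psi>"
    unfolding solution_def is_size_subst_def using dom fin finite_subset by auto
  then show "satisfiable (Constraints K)" unfolding satisfiable_def by blast
next
  assume "satisfiable (Constraints K)"
  then obtain \<phi> where "solution (Constraints K) \<phi>" by (auto simp: satisfiable_def)
  then have "\<forall>k \<in> K. satisfies \<phi> k" by (auto simp: solution_def satisfies_def)
  then show "\<exists>\<phi>. \<forall>k \<in> K. satisfies \<phi> k" by blast
qed

lemma runs_SOLVE:
  fixes ks :: "('v, 'c) constraint list"
  assumes "distinct ks"
  defines "n \<equiv> symbols (Constraints (set ks))"
  shows "runs SOLVE (input_store (Pair Nul (code_list ks))) (\<lambda>t s.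
    t \<le> (iterations n + 1) * (body_time n + 2) + 20 \<and>
    (s 0 \<noteq> Nul \<longleftrightarrow> satisfiable (Constraints (set ks))))"
proof -
  define V where "V = vars_problem (Constraints (set ks))"
  have V1: "finite V" by (auto simp: V_def finite_vars_xsz)
  have card_sz: "card (vars_sz a) \<le> symbols_sz a" for a :: "('v, 'c) sz" by (induction a) auto
  have card_xsz: "card (vars_xsz a) \<le> symbols_xsz a" for a :: "('v, 'c) xsz"
    by (cases a) (auto simp: card_sz)
  have "card V \<le> (\<Sum>k \<in> set ks. card (case k of (a, b) \<Rightarrow> vars_xsz a \<union> vars_xsz b))"
    unfolding V_def by (simp add: card_UN_le)
  also have "\<dots> \<le> n"
    unfolding n_def symbols.simps
  proof (rule sum_mono, clarify)
    fix a b :: "('v, 'c) xsz"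
    show "card (vars_xsz a \<union> vars_xsz b) \<le> symbols_xsz a + 1 + symbols_xsz b"
      using card_Un_le[of "vars_xsz a" "vars_xsz b"] card_xsz[of a] card_xsz[of b] by linarith
  qed
  finally have V2: "card V \<le> n" .
  have V3: "vars_xsz a \<union> vars_xsz b \<subseteq> V" if "(a, b) \<in> set ks" for a b
    using that by (auto simp: V_def)
  have height_sz: "height a \<le> symbols_sz a" for a :: "('v, 'c) sz" by (induction a) auto
  have height_xsz: "xheight a \<le> symbols_xsz a" for a :: "('v, 'c) xsz"
    by (cases a) (auto simp: height_sz)
  have h: "xheight a \<le> n \<and> xheight b \<le> n" if "(a, b) \<in> set ks" for a b
  proof -
    have "(case (a, b) of (a, b) \<Rightarrow> symbols_xsz a + 1 + symbols_xsz b) \<le> n"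
      unfolding n_def symbols.simps by (rule member_le_sum[OF that]) auto
    with height_xsz[of a] height_xsz[of b] show ?thesis by simp
  qed
  \<comment> \<open>Every constraint contributes at least its own relation symbol.\<close>
  have "card (set ks) \<le> n"
    unfolding n_def symbols.simps card_eq_sum by (rule sum_mono) auto
  then have len: "length ks \<le> n" using distinct_card[OF assms(1)] by simp
  let ?m = "potential V (n * card V + 1) ([] :: ('v, 'c) env) * (length ks + 1) + length ks"
  have "?m = card V * (n * card V + 1) * (length ks + 1) + length ks"
    by (simp add: potential_def weight_def)
  also have "\<dots> \<le> iterations n"
    unfolding iterations_def using V2 len by (intro add_mono mult_le_mono) auto
  finally have m: "?m \<le> iterations n" .
  let ?s = "(input_store (Pair Nul (code_list ks)))(1 := code_list ks, 3 := code_list ks)"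
  have init: "solve_inv ks V n ?m ?s"
    unfolding solve_inv_def
    apply (intro conjI disjI2)
    subgoal by simp
    subgoal by (simp add: input_store_def)
    subgoal
      apply (rule exI[of _ "[]"], rule exI[of _ "[]"], rule exI[of _ ks])
      by (simp add: bounded_env_Nil input_store_def)
    done
  have "runs (WHILE (X 3) BODY) ?s (\<lambda>t s'. t \<le> (?m + 1) * (body_time n + 1 + exp_cost (X 3)) \<and>
      (\<exists>m'. solve_inv ks V n m' s') \<and> eval_exp (X 3) s' = Nul)"
    by (rule runs_WHILE_measure[where I = "solve_inv ks V n", OF _ init], rule solve_inv_BODY[OF V1 V2 V3 h]) auto
  \<comment> \<open>The 12 steps cover the test and the two assignments before the loop.\<close>
  then have "runs (WHILE (X 3) BODY) ?s (\<lambda>t s. t + 12 \<le> (iterations n + 1) * (body_time n + 2) + 20 \<and>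
    (s 0 \<noteq> Nul \<longleftrightarrow> satisfiable (Constraints (set ks))))"
  proof (rule runs_mono, elim conjE exE)
    fix t s' m'
    assume t: "t \<le> (?m + 1) * (body_time n + 1 + exp_cost (X 3))"
      and inv: "solve_inv ks V n m' s'" and s3: "eval_exp (X 3) s' = Nul"
    have "(?m + 1) * (body_time n + 2) \<le> (iterations n + 1) * (body_time n + 2)"
      by (rule mult_le_mono1) (use m in simp)
    with t have "t + 12 \<le> (iterations n + 1) * (body_time n + 2) + 20" by simp
    moreover have "s' 0 \<noteq> Nul \<longleftrightarrow> (\<exists>\<phi>. \<forall>k \<in> set ks. satisfies \<phi> k)"
    proof (cases "s' 0 = Nul")
      case True
      then show ?thesis using inv by (auto simp: solve_inv_def)
    next
      case False
      \<comment> \<open>At a successful exit nothing remains to be checked, so \<open>env U\<close>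
        itself satisfies all constraints.\<close>
      with inv obtain U pre p where p: "s' 3 = code_list p" "ks = pre @ p"
          "\<forall>k \<in> set pre. satisfies (env U) k"
        unfolding solve_inv_def by blast
      from p(1) s3 have "p = []" by (cases p) auto
      with p False show ?thesis by auto
    qed
    ultimately show "t + 12 \<le> (iterations n + 1) * (body_time n + 2) + 20 \<and>
      (s' 0 \<noteq> Nul \<longleftrightarrow> satisfiable (Constraints (set ks)))"
      by (simp add: satisfiable_iff_satisfies)
  qed
  then show ?thesis
    unfolding SOLVE_def
    apply (simp add: input_store_def)
    apply (erule runs_mono)
    apply simp
    done
qed

theorem mainTheorem6:
  assumes "infinite (UNIV :: 'c set)"
  shows "polytime_decidable {P :: ('v, 'c) problem. is_size_problem P} problem_codes symbols satisfiable"
proof -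
  \<comment> \<open>The time bound of \<open>runs_SOLVE\<close>, with the indeterminate
    \<open>?x\<close> in place of \<open>n\<close>.\<close>
  let ?x = "[:0, 1:] :: nat poly"
  let ?p = "((?x * (?x * ?x + 1) * (?x + 1) + ?x) + 1) *
    (([:74:] * ?x + [:32:] * (?x * (?x * ?x + 1)) + [:20:] * (?x * ?x) + [:300:]) + [:2:]) + [:20:]"
  have p: "poly ?p n = (iterations n + 1) * (body_time n + 2) + 20" for n
    by (simp add: iterations_def body_time_def algebra_simps)
  have "\<exists>t s. exec SOLVE (input_store d) t s \<and> t \<le> poly ?p (symbols P) \<and> (s 0 \<noteq> Nul \<longleftrightarrow> satisfiable P)"
    if d: "d \<in> problem_codes P" for P :: "('v, 'c) problem" and d
  proof (cases P)
    case Bot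
    have "runs SOLVE (input_store d) (\<lambda>t s. t \<le> 20 \<and> s 0 = Nul)"
      using d Bot by (simp add: SOLVE_def input_store_def)
    moreover have "\<not> satisfiable P" using Bot by (simp add: satisfiable_def solution_def)
    moreover have "20 \<le> poly ?p (symbols P)" unfolding p by simp
    ultimately show ?thesis unfolding runs_def by (meson le_trans)
  next
    case (Constraints K)
    then obtain ks where "d = Pair Nul (code_list ks)" "set ks = K" "distinct ks"
      using d by auto
    then show ?thesis
      using runs_SOLVE[of ks] Constraints unfolding p runs_def by simp
  qed
  then show ?thesis unfolding polytime_decidable_def by blast
qed

end
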